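(* Let $\Gamma$ be a connected, non-complete edge-regular graph on $v$ vertices with valency $k$, and let $\theta_{Cmin}$ be the smallest eigenvalue of the adjacency matrix of the complement $\overline{\Gamma}$ of $\Gamma$. Then the following are equivalent: (1) $\Gamma$ is a strongly regular Neumaier graph; (2) there exists a clique $C$ of $\Gamma$ whose size attains the Hoffman coclique bound in $\overline{\Gamma}$, i.e. $|C|=\dfrac{v}{1-\frac{v-k-1}{\theta_{Cmin}}}$.
   Context: A graph is edge-regular if it is regular and any two adjacent vertices have the same number of common neighbours. A clique $C$ in a regular graph is a regular clique if every vertex outside $C$ is adjacent to the same positive number of vertices of $C$. A Neumaier graph is a non-complete edge-regular graph containing a regular clique. The complement $\overline{\Gamma}$ is regular of valency $v-k-1$, and the Hoffman bound states that every coclique of a regular graph of valency $k'\ge1$ on $v$ vertices with smallest eigenvalue $\theta'$ has at most $v(1-k'/\theta')^{-1}$ vertices. *)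

theory Defs
  imports
    "Graph_Theory.Graph_Theory"
    "Jordan_Normal_Form.Spectral_Radius"
begin

text \<open>
  Finite simple graphs are modelled by the locale \<open>pair_graph\<close>: a finite vertex set \<open>pverts G\<close>
  and a symmetric, irreflexive adjacency relation \<open>parcs G\<close> on it, so that an
  edge is represented by both of its orientations.
\<close>

definition complete_graph :: "'a pair_pre_digraph \<Rightarrow> bool" where
  "complete_graph G \<longleftrightarrow> complete_digraph (card (pverts G)) (with_proj G)"

definition graph_complement :: "'a pair_pre_digraph \<Rightarrow> 'a pair_pre_digraph" where
  "graph_complement G =
     \<lparr> pverts = pverts G,
       parcs = {(u, w). u \<in> pverts G \<and> w \<in> pverts G \<and> u \<noteq> w \<and> (u, w) \<notin> parcs G} \<rparr>"

definition neighbours :: "'a pair_pre_digraph \<Rightarrow> 'a \<Rightarrow> 'a set" where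
  "neighbours G u = {w. (u, w) \<in> parcs G}"

definition regular_graph :: "'a pair_pre_digraph \<Rightarrow> nat \<Rightarrow> bool" where
  "regular_graph G k \<longleftrightarrow> (\<forall>u \<in> pverts G. card (neighbours G u) = k)"

definition edge_regular :: "'a pair_pre_digraph \<Rightarrow> bool" where
  "edge_regular G \<longleftrightarrow>
     (\<exists>k. regular_graph G k) \<and>
     (\<exists>l. \<forall>(u, w) \<in> parcs G. card (neighbours G u \<inter> neighbours G w) = l)"

text \<open>
  Complete and edgeless graphs, which some authors exclude, satisfy this predicate.
\<close>

definition strongly_regular :: "'a pair_pre_digraph \<Rightarrow> bool" where
  "strongly_regular G \<longleftrightarrow>
     edge_regular G \<and>
     (\<exists>m. \<forall>u \<in> pverts G. \<forall>w \<in> pverts G. u \<noteq> w \<and> (u, w) \<notin> parcs G \<longrightarrow>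
        card (neighbours G u \<inter> neighbours G w) = m)"

definition clique :: "'a pair_pre_digraph \<Rightarrow> 'a set \<Rightarrow> bool" where
  "clique G C \<longleftrightarrow> C \<subseteq> pverts G \<and> (\<forall>u \<in> C. \<forall>w \<in> C. u \<noteq> w \<longrightarrow> (u, w) \<in> parcs G)"

definition regular_clique :: "'a pair_pre_digraph \<Rightarrow> 'a set \<Rightarrow> bool" where
  "regular_clique G C \<longleftrightarrow>
     clique G C \<and> (\<exists>e > 0. \<forall>u \<in> pverts G - C. card (neighbours G u \<inter> C) = e)"

definition neumaier_graph :: "'a pair_pre_digraph \<Rightarrow> bool" where
  "neumaier_graph G \<longleftrightarrow>
     \<not> complete_graph G \<and> edge_regular G \<and> (\<exists>C. regular_clique G C)"

text \<open>
  Rows and columns follow the list \<open>vs\<close>, which is meant to enumerate the vertices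
  without repetition. Reordering \<open>vs\<close> conjugates the matrix by a permutation matrix.
\<close>

definition adjacency_matrix :: "'a list \<Rightarrow> 'a pair_pre_digraph \<Rightarrow> real mat" where
  "adjacency_matrix vs G =
     mat (length vs) (length vs) (\<lambda>(i, j). if (vs ! i, vs ! j) \<in> parcs G then 1 else 0)"

text \<open>
  For a symmetric real matrix of positive dimension the real spectrum is finite and
  nonempty, so this minimum exists.
\<close>

definition smallest_eigenvalue :: "real mat \<Rightarrow> real" where
  "smallest_eigenvalue A = Min (spectrum A)"

end

theory Submission
  imports Defs "HOL-Analysis.Function_Topology"
begin

text \<open>
  Let \<open>A\<close> be the adjacency matrix of \<open>G\<close> and \<open>\<tau> = -1 - \<theta>\<close>. Orthogonally to the all-one vector, the
  adjacency matrix of the complement is \<open>-1 - A\<close>, so minimality of \<open>\<theta>\<close> says exactly that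
  \<open>B = \<tau> I - A + ((k - \<tau>) / v) J\<close> is positive semidefinite, and a vector on which its quadratic form
  vanishes lies in its kernel.

  If a clique \<open>C\<close> of size \<open>s\<close> attains the bound, the form vanishes at the indicator vector of \<open>C\<close>, and
  \<open>B 1\<^sub>C = 0\<close> says that \<open>C\<close> is regular with nexus \<open>s - 1 - \<tau>\<close>; connectedness makes the nexus positive.
  With \<open>m = k / (s - 1)\<close>, edge-regularity determines the form on every column of \<open>A + m I\<close>, and its
  value turns out to be \<open>0\<close>. Hence \<open>B (A + m I) = 0\<close>, which makes the number of common neighbours of
  nonadjacent vertices constant.

  Conversely, for a strongly regular graph with a regular clique \<open>C\<close> of nexus \<open>e\<close>, the projection of
  \<open>1\<^sub>C\<close> orthogonal to the all-one vector is an eigenvector of \<open>A\<close> for \<open>s - 1 - e \<ge> 0\<close>. The nonprincipal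
  eigenvalues are the two roots of a quadratic with nonpositive product, so \<open>s - 1 - e\<close> is the larger
  one and \<open>\<theta> = e - s\<close>.
\<close>

section \<open>Semidefinite forms and extremal eigenvectors\<close>

text \<open>Moving \<open>y\<close> by \<open>t\<close> in coordinate \<open>i\<close> changes the
  form by \<open>2 * t * r + t\<^sup>2 * b i i\<close>, where \<open>r\<close> is the sum in the
  conclusion. Were \<open>r\<close> nonzero, a small \<open>t\<close> of the opposite sign would
  make the form negative.\<close>

lemma psd_form_zero:
  fixes b :: "'a \<Rightarrow> 'a \<Rightarrow> real"
  assumes "finite V"
    and sym: "\<And>u w. b u w = b w u"
    and psd: "\<And>x. 0 \<le> (\<Sum>u\<in>V. \<Sum>w\<in>V. b u w * x u * x w)"
    and zero: "(\<Sum>u\<in>V. \<Sum>w\<in>V. b u w * y u * y w) = 0"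
    and "i \<in> V"
  shows "(\<Sum>w\<in>V. b i w * y w) = 0"
proof (rule ccontr)
  let ?d = "\<lambda>u. if u = i then 1 else 0 :: real"
  define r where "r = (\<Sum>w\<in>V. b i w * y w)"
  assume "(\<Sum>w\<in>V. b i w * y w) \<noteq> 0"
  hence r: "r \<noteq> 0" by (simp add: r_def)
  have d1: "(\<Sum>u\<in>V. \<Sum>w\<in>V. b u w * ?d u * y w) = r"
  proof -
    have "(\<Sum>u\<in>V. \<Sum>w\<in>V. b u w * ?d u * y w) = (\<Sum>u\<in>V. if u = i then \<Sum>w\<in>V. b u w * y w else 0)"
      by (intro sum.cong refl) auto
    thus ?thesis using assms by (simp add: r_def)
  qed
  have d2: "(\<Sum>u\<in>V. \<Sum>w\<in>V. b u w * y u * ?d w) = r"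
    unfolding d1[symmetric] by (subst sum.swap) (auto intro!: sum.cong simp: sym)
  have d3: "(\<Sum>u\<in>V. \<Sum>w\<in>V. b u w * ?d u * ?d w) = b i i"
  proof -
    have "(\<Sum>u\<in>V. \<Sum>w\<in>V. b u w * ?d u * ?d w) = (\<Sum>u\<in>V. if u = i then \<Sum>w\<in>V. if w = i then b u w else 0 else 0)"
      by (intro sum.cong refl) (auto intro!: sum.cong)
    thus ?thesis using assms by simp
  qed
  have quad: "0 \<le> 2 * t * r + t\<^sup>2 * b i i" for t
  proof -
    have "(\<Sum>u\<in>V. \<Sum>w\<in>V. b u w * (y u + t * ?d u) * (y w + t * ?d w))
        = (\<Sum>u\<in>V. \<Sum>w\<in>V. b u w * y u * y w + t * (b u w * ?d u * y w)
            + t * (b u w * y u * ?d w) + t\<^sup>2 * (b u w * ?d u * ?d w))"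
      by (intro sum.cong refl) (simp add: algebra_simps power2_eq_square)
    also have "\<dots> = 0 + t * r + t * r + t\<^sup>2 * b i i"
      by (simp only: sum.distrib sum_distrib_left[symmetric] zero d1 d2 d3)
    finally show ?thesis using psd[of "\<lambda>u. y u + t * ?d u"] by (simp add: mult_ac)
  qed
  \<comment> \<open>Any positive \<open>c\<close> above \<open>b i i\<close> serves: at
    \<open>t = - r / c\<close> the linear term then outweighs the quadratic one. The summand 1
    covers \<open>b i i = 0\<close>.\<close>
  define c where "c = \<bar>b i i\<bar> + 1"
  hence "c > 0" by simp
  have "0 \<le> 2 * (- r / c) * r + (- r / c)\<^sup>2 * b i i" by (rule quad)
  also have "\<dots> \<le> 2 * (- r / c) * r + (- r / c)\<^sup>2 * c"
    by (intro add_left_mono mult_left_mono) (auto simp: c_def)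
  also have "\<dots> = - r\<^sup>2 / c"
    using \<open>c > 0\<close> by (simp add: power2_eq_square field_simps)
  also have "\<dots> < 0" using r \<open>c > 0\<close> by simp
  finally show False by simp
qed

text \<open>The Rayleigh quotient attains its minimum by compactness of the unit sphere. Subtracting
  that minimum from the diagonal of \<open>b\<close> leaves a semidefinite form vanishing at the
  minimiser, so \<open>psd_form_zero\<close> makes the minimiser an eigenvector.\<close>

lemma symmetric_smallest_eigenpair:
  fixes b :: "'a \<Rightarrow> 'a \<Rightarrow> real"
  assumes fin: "finite V" and "V \<noteq> {}"
    and sym: "\<And>u w. b u w = b w u"
  obtains \<mu> x where "\<exists>u\<in>V. x u \<noteq> 0" "\<And>u. u \<in> V \<Longrightarrow> (\<Sum>w\<in>V. b u w * x w) = \<mu> * x u"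
    "\<And>y. \<mu> * (\<Sum>u\<in>V. (y u)\<^sup>2) \<le> (\<Sum>u\<in>V. \<Sum>w\<in>V. b u w * y u * y w)"
proof -
  define Q where "Q = (\<lambda>x::'a \<Rightarrow> real. \<Sum>u\<in>V. \<Sum>w\<in>V. b u w * x u * x w)"
  define N where "N = (\<lambda>x::'a \<Rightarrow> real. \<Sum>u\<in>V. (x u)\<^sup>2)"
  \<comment> \<open>Vectors are functions on the whole type, so coordinates outside \<open>V\<close>
    are pinned to 0; the product of intervals and points is compact by Tychonoff, and it contains
    every unit vector extended by 0.\<close>
  define K where "K = PiE UNIV (\<lambda>u. if u \<in> V then {-1..1} else {0::real})"
  have "compact K"
  proof -
    have "compactin (product_topology (\<lambda>_::'a. euclideanreal) UNIV) K"
      unfolding K_def compactin_PiE by auto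
    thus ?thesis unfolding euclidean_product_topology compactin_euclidean_iff .
  qed
  have contN: "continuous_on A N" and contQ: "continuous_on A Q" for A
    unfolding N_def Q_def by (intro continuous_intros continuous_on_subset[OF continuous_on_product_coordinates] subset_UNIV)+
  have "closed {x. N x = 1}"
    by (intro closed_Collect_eq contN continuous_on_const)
  hence "compact (K \<inter> {x. N x = 1})"
    by (rule compact_Int_closed[OF \<open>compact K\<close>])
  moreover have "K \<inter> {x. N x = 1} \<noteq> {}"
  proof -
    obtain i where "i \<in> V" using \<open>V \<noteq> {}\<close> by blast
    have "N (\<lambda>u. if u = i then 1 else 0) = (\<Sum>u\<in>V. if u = i then 1 else 0)"
      unfolding N_def by (intro sum.cong) auto
    also have "\<dots> = 1" using fin \<open>i \<in> V\<close> by simp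
    finally have "(\<lambda>u. if u = i then 1 else 0) \<in> K \<inter> {x. N x = 1}"
      using \<open>i \<in> V\<close> by (auto simp: K_def)
    thus ?thesis by blast
  qed
  ultimately obtain x where x: "x \<in> K" "N x = 1"
    and min: "\<And>y. y \<in> K \<Longrightarrow> N y = 1 \<Longrightarrow> Q x \<le> Q y"
    using continuous_attains_inf[OF _ _ contQ, of "K \<inter> {x. N x = 1}"] by blast
  have bound: "Q x * N y \<le> Q y" for y
  proof (cases "N y = 0")
    case True
    hence "\<forall>u\<in>V. y u = 0" using fin by (simp add: N_def sum_nonneg_eq_0_iff)
    hence "Q y = 0" by (simp add: Q_def)
    with True show ?thesis by simp
  next
    case False
    have "N y \<ge> 0" by (simp add: N_def sum_nonneg)
    with False have pos: "N y > 0" by simp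
    \<comment> \<open>Normalising moves \<open>y\<close> to the sphere; setting it to 0 outside
      \<open>V\<close> puts it into \<open>K\<close> and changes neither \<open>N\<close> nor
      \<open>Q\<close>.\<close>
    define z where "z = (\<lambda>u. if u \<in> V then y u / sqrt (N y) else 0)"
    have Nz: "N z = N y / N y"
      using pos by (simp add: N_def[of] z_def power_divide sum_divide_distrib[symmetric])
    have Qz: "Q z = Q y / N y"
      unfolding Q_def sum_divide_distrib using pos
      by (intro sum.cong refl) (simp add: z_def field_simps)
    have "z \<in> K"
    proof -
      have "\<bar>z u\<bar> \<le> 1" if "u \<in> V" for u
      proof -
        have "(z u)\<^sup>2 \<le> N z"
          unfolding N_def using fin that by (intro member_le_sum) auto
        thus ?thesis using Nz pos by (simp add: abs_square_le_1)
      qed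
      hence "z u \<in> (if u \<in> V then {-1..1} else {0})" for u
        by (cases "u \<in> V") (force simp: abs_le_iff, simp add: z_def)
      thus ?thesis unfolding K_def by blast
    qed
    from min[OF this] Nz Qz pos show ?thesis by (simp add: field_simps)
  qed
  define c where "c = (\<lambda>u w. b u w - (if u = w then Q x else 0))"
  have c: "(\<Sum>w\<in>V. c u w * y w) = (\<Sum>w\<in>V. b u w * y w) - Q x * y u" if "u \<in> V" for y u
  proof -
    have "(\<Sum>w\<in>V. c u w * y w) = (\<Sum>w\<in>V. b u w * y w - (if u = w then Q x * y w else 0))"
      by (intro sum.cong refl) (auto simp: c_def algebra_simps)
    thus ?thesis using fin that by (simp add: sum_subtractf)
  qed
  have Qc: "(\<Sum>u\<in>V. \<Sum>w\<in>V. c u w * y u * y w) = Q y - Q x * N y" for y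
  proof -
    have "(\<Sum>u\<in>V. \<Sum>w\<in>V. c u w * y u * y w) = (\<Sum>u\<in>V. y u * (\<Sum>w\<in>V. c u w * y w))"
      by (simp add: sum_distrib_left mult_ac)
    also have "\<dots> = (\<Sum>u\<in>V. y u * (\<Sum>w\<in>V. b u w * y w) - Q x * (y u)\<^sup>2)"
      by (intro sum.cong refl) (simp only: c, simp add: algebra_simps power2_eq_square)
    also have "\<dots> = (\<Sum>u\<in>V. y u * (\<Sum>w\<in>V. b u w * y w)) - Q x * N y"
      by (simp only: N_def sum_subtractf sum_distrib_left[symmetric])
    also have "(\<Sum>u\<in>V. y u * (\<Sum>w\<in>V. b u w * y w)) = Q y"
      by (simp add: Q_def sum_distrib_left mult_ac)
    finally show ?thesis .
  qed
  have "(\<Sum>w\<in>V. b u w * x w) = Q x * x u" if "u \<in> V" for u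
  proof -
    have "c p q = c q p" for p q by (simp add: c_def sym)
    moreover have "0 \<le> (\<Sum>u\<in>V. \<Sum>w\<in>V. c u w * y u * y w)" for y
      unfolding Qc using bound[of y] by simp
    moreover have "(\<Sum>u\<in>V. \<Sum>w\<in>V. c u w * x u * x w) = 0"
      unfolding Qc using x(2) by simp
    ultimately have "(\<Sum>w\<in>V. c u w * x w) = 0"
      using psd_form_zero[OF fin] that by blast
    with c[OF that] show ?thesis by simp
  qed
  moreover have "\<exists>u\<in>V. x u \<noteq> 0"
  proof (rule ccontr)
    assume "\<not> ?thesis"
    hence "N x = 0" by (simp add: N_def)
    with x(2) show False by simp
  qed
  ultimately show thesis
    using that bound unfolding Q_def N_def by blast
qed

section \<open>Spectra of matrices indexed by vertices\<close>

text \<open>Since \<open>vs\<close> has no repetition, positions and vertices correspond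
  bijectively. This lets the later arguments work with functions on vertices instead of vectors and
  matrices.\<close>

lemma eigenvalue_mat_iff:
  fixes b :: "'a \<Rightarrow> 'a \<Rightarrow> real"
  assumes dist: "distinct vs"
  shows "eigenvalue (mat (length vs) (length vs) (\<lambda>(i, j). b (vs ! i) (vs ! j))) \<mu> \<longleftrightarrow>
    (\<exists>x. (\<exists>u\<in>set vs. x u \<noteq> 0) \<and> (\<forall>u\<in>set vs. (\<Sum>w\<in>set vs. b u w * x w) = \<mu> * x u))"
    (is "eigenvalue ?A \<mu> \<longleftrightarrow> ?R")
proof -
  let ?n = "length vs"
  have reindex: "(\<Sum>w\<in>set vs. f w) = (\<Sum>j = 0..<?n. f (vs ! j))" for f :: "'a \<Rightarrow> real"
    using bij_betw_nth[OF dist refl refl]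
    by (simp add: sum.reindex_bij_betw[symmetric] atLeast0LessThan)
  show ?thesis
  proof
    assume "eigenvalue ?A \<mu>"
    then obtain z where z: "z \<in> carrier_vec ?n" "z \<noteq> 0\<^sub>v ?n" "?A *\<^sub>v z = \<mu> \<cdot>\<^sub>v z"
      by (auto simp: eigenvalue_def eigenvector_def)
    \<comment> \<open>\<open>distinct vs\<close> makes the position unique; the values of
      \<open>x\<close> off \<open>set vs\<close> are unspecified and never enter.\<close>
    define x where "x = (\<lambda>u. z $ (THE i. i < ?n \<and> vs ! i = u))"
    have x: "x (vs ! i) = z $ i" if "i < ?n" for i
    proof -
      have "(THE j. j < ?n \<and> vs ! j = vs ! i) = i"
        using that dist by (auto simp: nth_eq_iff_index_eq)
      thus ?thesis by (simp add: x_def)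
    qed
    have "\<exists>i<?n. z $ i \<noteq> 0"
    proof (rule ccontr)
      assume "\<not> ?thesis"
      with z(1) have "z = 0\<^sub>v ?n" by (intro eq_vecI) auto
      with z(2) show False by blast
    qed
    hence "\<exists>u\<in>set vs. x u \<noteq> 0" using x by (metis nth_mem)
    moreover have "(\<Sum>w\<in>set vs. b (vs ! i) w * x w) = \<mu> * x (vs ! i)" if "i < ?n" for i
    proof -
      have "(?A *\<^sub>v z) $ i = (\<mu> \<cdot>\<^sub>v z) $ i" by (simp only: z(3))
      thus ?thesis using that z(1) by (simp add: reindex x scalar_prod_def)
    qed
    ultimately show ?R by (intro exI[of _ x]) (auto simp: in_set_conv_nth)
  next
    assume ?R
    then obtain x where x: "\<exists>u\<in>set vs. x u \<noteq> 0"
      "\<forall>u\<in>set vs. (\<Sum>w\<in>set vs. b u w * x w) = \<mu> * x u" by blast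
    define z where "z = vec ?n (\<lambda>i. x (vs ! i))"
    obtain i where "i < ?n" "x (vs ! i) \<noteq> 0" using x(1) by (auto simp: in_set_conv_nth)
    hence "z \<noteq> 0\<^sub>v ?n" by (auto simp: z_def dest!: arg_cong[of _ _ "\<lambda>y. y $ i"])
    moreover have "?A *\<^sub>v z = \<mu> \<cdot>\<^sub>v z"
      using x(2) by (intro eq_vecI) (auto simp: z_def scalar_prod_def reindex)
    ultimately show "eigenvalue ?A \<mu>"
      by (auto simp: eigenvalue_def eigenvector_def z_def intro!: exI[of _ z])
  qed
qed

text \<open>The minimal Rayleigh quotient is itself an eigenvalue, and evaluating the form at an
  eigenvector for \<open>\<nu>\<close> shows that it is at most \<open>\<nu>\<close>. Hence it is
  the \<open>Min\<close> of the spectrum.\<close>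

lemma smallest_eigenvalue_symmetric:
  fixes b :: "'a \<Rightarrow> 'a \<Rightarrow> real"
  assumes dist: "distinct vs" and "vs \<noteq> []"
    and sym: "\<And>u w. b u w = b w u"
    and \<theta>: "\<theta> = smallest_eigenvalue (mat (length vs) (length vs) (\<lambda>(i, j). b (vs ! i) (vs ! j)))"
  shows smallest_eigenvalue_eigenvector:
      "\<exists>x. (\<exists>u\<in>set vs. x u \<noteq> 0) \<and> (\<forall>u\<in>set vs. (\<Sum>w\<in>set vs. b u w * x w) = \<theta> * x u)"
    and smallest_eigenvalue_Rayleigh:
      "\<theta> * (\<Sum>u\<in>set vs. (y u)\<^sup>2) \<le> (\<Sum>u\<in>set vs. \<Sum>w\<in>set vs. b u w * y u * y w)"
proof -
  let ?V = "set vs"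
  define A where "A = mat (length vs) (length vs) (\<lambda>(i, j). b (vs ! i) (vs ! j))"
  have V: "finite ?V" "?V \<noteq> {}" using \<open>vs \<noteq> []\<close> by auto
  obtain \<mu> x where x: "\<exists>u\<in>?V. x u \<noteq> 0" "\<And>u. u \<in> ?V \<Longrightarrow> (\<Sum>w\<in>?V. b u w * x w) = \<mu> * x u"
    and bound: "\<And>y. \<mu> * (\<Sum>u\<in>?V. (y u)\<^sup>2) \<le> (\<Sum>u\<in>?V. \<Sum>w\<in>?V. b u w * y u * y w)"
    by (rule symmetric_smallest_eigenpair[of ?V b, OF V sym]) (rule that)
  have "Min (spectrum A) = \<mu>"
  proof (rule Min_eqI)
    show "finite (spectrum A)"
      by (rule card_finite_spectrum(1)[of _ "length vs"]) (simp add: A_def)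
    show "\<mu> \<in> spectrum A"
      using x by (auto simp: spectrum_def A_def eigenvalue_mat_iff[OF dist])
    show "\<mu> \<le> \<nu>" if "\<nu> \<in> spectrum A" for \<nu>
    proof -
      from that obtain y where y: "\<exists>u\<in>?V. y u \<noteq> 0" "\<forall>u\<in>?V. (\<Sum>w\<in>?V. b u w * y w) = \<nu> * y u"
        by (auto simp: spectrum_def A_def eigenvalue_mat_iff[OF dist])
      have "(\<Sum>u\<in>?V. \<Sum>w\<in>?V. b u w * y u * y w) = (\<Sum>u\<in>?V. y u * (\<Sum>w\<in>?V. b u w * y w))"
        by (simp add: sum_distrib_left mult_ac)
      also have "\<dots> = (\<Sum>u\<in>?V. \<nu> * (y u)\<^sup>2)"
        using y(2) by (intro sum.cong) (auto simp: power2_eq_square)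
      also have "\<dots> = \<nu> * (\<Sum>u\<in>?V. (y u)\<^sup>2)" by (simp add: sum_distrib_left)
      finally have "\<mu> * (\<Sum>u\<in>?V. (y u)\<^sup>2) \<le> \<nu> * (\<Sum>u\<in>?V. (y u)\<^sup>2)" using bound[of y] by simp
      moreover have "(\<Sum>u\<in>?V. (y u)\<^sup>2) > 0"
        using y(1) by (auto intro: sum_pos2)
      ultimately show ?thesis by simp
    qed
  qed
  hence "\<theta> = \<mu>" by (simp add: \<theta> A_def smallest_eigenvalue_def)
  with x bound show "\<exists>x. (\<exists>u\<in>?V. x u \<noteq> 0) \<and> (\<forall>u\<in>?V. (\<Sum>w\<in>?V. b u w * x w) = \<theta> * x u)"
    and "\<theta> * (\<Sum>u\<in>?V. (y u)\<^sup>2) \<le> (\<Sum>u\<in>?V. \<Sum>w\<in>?V. b u w * y u * y w)"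
    by auto
qed

section \<open>Equality in the bound for vectors orthogonal to the all-one vector\<close>

text \<open>The matrix \<open>c = \<tau> I + r J - b\<close> kills the all-one vector and is
  nonnegative on its orthogonal complement, hence semidefinite. The hypothesis \<open>eq\<close>
  says that its form vanishes at \<open>y\<close>, and the conclusion is row \<open>i\<close> of
  \<open>c y = 0\<close>.\<close>

lemma second_eigenvalue_equality:
  fixes b :: "'a \<Rightarrow> 'a \<Rightarrow> real" and y :: "'a \<Rightarrow> real"
  assumes fin: "finite V" and "V \<noteq> {}"
    and sym: "\<And>u w. b u w = b w u"
    and row: "\<And>u. u \<in> V \<Longrightarrow> (\<Sum>w\<in>V. b u w) = d"
    and bound: "\<And>z. (\<Sum>u\<in>V. z u) = 0 \<Longrightarrow>
      (\<Sum>u\<in>V. \<Sum>w\<in>V. b u w * z u * z w) \<le> \<tau> * (\<Sum>u\<in>V. (z u)\<^sup>2)"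
    and eq: "(\<Sum>u\<in>V. \<Sum>w\<in>V. b u w * y u * y w)
      = \<tau> * (\<Sum>u\<in>V. (y u)\<^sup>2) + (d - \<tau>) / card V * (\<Sum>u\<in>V. y u)\<^sup>2"
    and "i \<in> V"
  shows "(\<Sum>w\<in>V. b i w * y w) = \<tau> * y i + (d - \<tau>) / card V * (\<Sum>u\<in>V. y u)"
proof -
  define v where "v = real (card V)"
  have "v > 0" using fin \<open>V \<noteq> {}\<close> by (simp add: v_def card_gt_0_iff)
  \<comment> \<open>The value for which every row of \<open>c\<close> sums to
    \<open>\<tau> + r * v - d = 0\<close>.\<close>
  define r where "r = (d - \<tau>) / v"
  define c where "c = (\<lambda>u w. (if u = w then \<tau> else 0) + r - b u w)"
  have c: "(\<Sum>w\<in>V. c u w * z w) = \<tau> * z u + r * (\<Sum>w\<in>V. z w) - (\<Sum>w\<in>V. b u w * z w)"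
    if "u \<in> V" for z u
  proof -
    have "(\<Sum>w\<in>V. c u w * z w)
        = (\<Sum>w\<in>V. (if u = w then \<tau> * z w else 0) + r * z w - b u w * z w)"
      by (intro sum.cong refl) (auto simp: c_def algebra_simps)
    thus ?thesis using fin that by (simp add: sum_subtractf sum.distrib sum_distrib_left)
  qed
  have form: "(\<Sum>u\<in>V. \<Sum>w\<in>V. g u w * z u * z w) = (\<Sum>u\<in>V. z u * (\<Sum>w\<in>V. g u w * z w))"
    for g :: "'a \<Rightarrow> 'a \<Rightarrow> real" and z
    by (simp add: sum_distrib_left mult_ac)
  have Qc: "(\<Sum>u\<in>V. \<Sum>w\<in>V. c u w * z u * z w) = \<tau> * (\<Sum>u\<in>V. (z u)\<^sup>2)
      + r * (\<Sum>u\<in>V. z u)\<^sup>2 - (\<Sum>u\<in>V. \<Sum>w\<in>V. b u w * z u * z w)" for z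
  proof -
    have "(\<Sum>u\<in>V. \<Sum>w\<in>V. c u w * z u * z w) = (\<Sum>u\<in>V. \<tau> * (z u)\<^sup>2
      + (r * (\<Sum>w\<in>V. z w)) * z u - z u * (\<Sum>w\<in>V. b u w * z w))"
      unfolding form by (intro sum.cong refl, simp only: c) (simp add: algebra_simps power2_eq_square)
    also have "\<dots> = \<tau> * (\<Sum>u\<in>V. (z u)\<^sup>2) + (r * (\<Sum>w\<in>V. z w)) * (\<Sum>u\<in>V. z u)
        - (\<Sum>u\<in>V. z u * (\<Sum>w\<in>V. b u w * z w))"
      by (simp only: sum_subtractf sum.distrib sum_distrib_left[symmetric])
    finally show ?thesis unfolding form[of b z] by (simp only: power2_eq_square mult.assoc)
  qed
  have c_sym: "c p q = c q p" for p q by (simp add: c_def sym)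
  have c_row: "(\<Sum>w\<in>V. c u w) = 0" if "u \<in> V" for u
    using c[OF that, of "\<lambda>_. 1"] row[OF that] \<open>v > 0\<close> by (simp add: r_def v_def)
  have psd: "0 \<le> (\<Sum>u\<in>V. \<Sum>w\<in>V. c u w * z u * z w)" for z
  proof -
    define t where "t = (\<Sum>u\<in>V. z u) / v"
    \<comment> \<open>The projection of \<open>z\<close> off the all-one vector. As rows and columns
      of \<open>c\<close> sum to 0, the form takes the same value at \<open>z\<close> and at
      \<open>z'\<close>.\<close>
    define z' where "z' = (\<lambda>u. z u - t)"
    have z': "(\<Sum>u\<in>V. z' u) = 0"
      using \<open>v > 0\<close> by (simp add: z'_def t_def sum_subtractf v_def)
    have row0: "(\<Sum>w\<in>V. c u w * f) = 0" if "u \<in> V" for u f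
      using c_row[OF that] by (simp add: sum_distrib_right[symmetric])
    have col0: "(\<Sum>u\<in>V. c u w * f) = 0" if "w \<in> V" for w f
      by (subst c_sym) (rule row0[OF that])
    have "(\<Sum>u\<in>V. \<Sum>w\<in>V. c u w * z' u * z' w) = (\<Sum>u\<in>V. z' u * (\<Sum>w\<in>V. c u w * z w))"
    proof -
      have "(\<Sum>w\<in>V. c u w * z' w) = (\<Sum>w\<in>V. c u w * z w)" if "u \<in> V" for u
        using row0[OF that, of t] by (simp add: z'_def right_diff_distrib sum_subtractf)
      thus ?thesis by (simp add: form)
    qed
    also have "\<dots> = (\<Sum>w\<in>V. (\<Sum>u\<in>V. c u w * z' u) * z w)"
      unfolding sum_distrib_left sum_distrib_right by (subst sum.swap) (simp add: mult_ac)
    also have "\<dots> = (\<Sum>w\<in>V. (\<Sum>u\<in>V. c u w * z u) * z w)"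
    proof (intro sum.cong refl)
      fix w assume "w \<in> V"
      show "(\<Sum>u\<in>V. c u w * z' u) * z w = (\<Sum>u\<in>V. c u w * z u) * z w"
        using col0[OF \<open>w \<in> V\<close>, of t] by (simp add: z'_def right_diff_distrib sum_subtractf)
    qed
    also have "\<dots> = (\<Sum>u\<in>V. \<Sum>w\<in>V. c u w * z u * z w)"
      unfolding sum_distrib_right by (rule sum.swap)
    finally show ?thesis using Qc[of z'] bound[OF z'] z' by simp
  qed
  have "(\<Sum>w\<in>V. c i w * y w) = 0"
    using eq by (intro psd_form_zero[OF fin c_sym psd _ \<open>i \<in> V\<close>]) (simp add: Qc r_def v_def)
  with c[OF \<open>i \<in> V\<close>] show ?thesis by (simp add: r_def v_def)
qed

section \<open>Adjacency sums of a graph and its complement\<close>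

text \<open>Indexing by vertices, not by positions in a list, turns matrix products into sums over
  \<open>pverts G\<close>.\<close>

definition adj :: "'a pair_pre_digraph \<Rightarrow> 'a \<Rightarrow> 'a \<Rightarrow> real" where
  "adj G u w = of_bool ((u, w) \<in> parcs G)"

lemma adj_complement:
  "u \<in> pverts G \<Longrightarrow> w \<in> pverts G \<Longrightarrow> (u, u) \<notin> parcs G \<Longrightarrow>
    adj (graph_complement G) u w = 1 - of_bool (u = w) - adj G u w"
  by (auto simp: adj_def graph_complement_def)

context pair_graph
begin

lemma adj_sym: "adj G u w = adj G w u"
  using arcs_symmetric[of u w] arcs_symmetric[of w u] by (auto simp: adj_def)

lemma adj_irrefl: "(u, u) \<notin> parcs G"
  using pair_no_loops by fastforce

lemma neighbours_subset: "neighbours G u \<subseteq> pverts G"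
  using arc_snd_in_verts by (fastforce simp: neighbours_def)

lemma finite_neighbours [simp]: "finite (neighbours G u)"
  using neighbours_subset pair_finite_verts by (rule finite_subset)

lemma sum_adj: "(\<Sum>w\<in>pverts G. adj G u w * f w) = (\<Sum>w\<in>neighbours G u. f w)"
proof -
  have "(\<Sum>w\<in>neighbours G u. f w) = (\<Sum>w\<in>neighbours G u. adj G u w * f w)"
    by (intro sum.cong) (auto simp: adj_def neighbours_def)
  also have "\<dots> = (\<Sum>w\<in>pverts G. adj G u w * f w)"
    by (intro sum.mono_neutral_left pair_finite_verts neighbours_subset)
      (auto simp: adj_def neighbours_def)
  finally show ?thesis by simp
qed

lemma sum_adj_indicator:
  "(\<Sum>w\<in>pverts G. adj G u w * of_bool (w \<in> C)) = card (neighbours G u \<inter> C)"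
  by (simp add: sum_adj of_bool_def sum.If_cases)

lemma sum_adj_adj:
  "(\<Sum>w\<in>pverts G. adj G u w * adj G w i) = card (neighbours G u \<inter> neighbours G i)"
proof -
  have "adj G w i = of_bool (w \<in> neighbours G i)" for w
    by (subst adj_sym) (simp add: adj_def neighbours_def)
  thus ?thesis by (simp add: sum_adj_indicator)
qed

lemma adj_complement_sym: "adj (graph_complement G) u w = adj (graph_complement G) w u"
  using arcs_symmetric by (auto simp: adj_def graph_complement_def)

text \<open>The identity \<open>J - I - A\<close> for the complement's adjacency matrix, applied to
  \<open>f\<close>.\<close>

lemma sum_adj_complement:
  assumes "u \<in> pverts G"
  shows "(\<Sum>w\<in>pverts G. adj (graph_complement G) u w * f w)
    = (\<Sum>w\<in>pverts G. f w) - f u - (\<Sum>w\<in>pverts G. adj G u w * f w)"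
proof -
  have "(\<Sum>w\<in>pverts G. adj (graph_complement G) u w * f w)
      = (\<Sum>w\<in>pverts G. f w - (if u = w then f w else 0) - adj G u w * f w)"
    using assms adj_irrefl by (intro sum.cong refl) (auto simp: adj_complement algebra_simps)
  thus ?thesis using assms pair_finite_verts by (simp add: sum_subtractf)
qed

lemma connected_boundary:
  assumes conn: "Digraph_Component.connected (with_proj G)"
    and "C \<subseteq> pverts G" "C \<noteq> {}" "C \<noteq> pverts G"
  obtains u w where "u \<in> pverts G - C" "w \<in> C" "(u, w) \<in> parcs G"
proof -
  obtain p q where pq: "p \<in> C" "q \<in> pverts G" "q \<notin> C" using assms by blast
  have "(p, q) \<in> rtrancl_on (pverts G) ((parcs G)\<^sup>s)"
    using conn pq assms(2) unfolding connected_conv by auto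
  \<comment> \<open>Invariant along a walk starting in \<open>C\<close>: either it is still in
    \<open>C\<close>, or an arc across the boundary has been met.\<close>
  hence "q \<in> C \<or> (\<exists>u w. u \<in> pverts G - C \<and> w \<in> C \<and> (u, w) \<in> parcs G)"
  proof (induction rule: rtrancl_on_induct)
    case base
    show ?case using pq by blast
  next
    case (step y z)
    thus ?case using arcs_symmetric by (auto simp: symcl_def)
  qed
  with pq that show thesis by blast
qed

lemma sum_adj_regular:
  "regular_graph G k \<Longrightarrow> u \<in> pverts G \<Longrightarrow> (\<Sum>w\<in>pverts G. adj G u w) = k"
  using sum_adj[of u "\<lambda>_. 1"] by (simp add: regular_graph_def)

lemma card_common_neighbours_le: "card (neighbours G u \<inter> neighbours G w) \<le> card (neighbours G u)"
  by (intro card_mono) auto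

lemma nonadjacent_pair:
  assumes "\<not> complete_graph G"
  obtains p q where "p \<in> pverts G" "q \<in> pverts G" "p \<noteq> q" "(p, q) \<notin> parcs G"
proof -
  have "parcs G \<noteq> {(u, w). (u, w) \<in> pverts G \<times> pverts G \<and> u \<noteq> w}"
    using assms pair_finite_verts by (simp add: complete_graph_def complete_digraph_pair_def)
  thus thesis
    using that adj_irrefl arc_fst_in_verts arc_snd_in_verts by fastforce
qed

text \<open>Both \<open>p\<close> and \<open>q\<close> lie outside the neighbourhood of
  \<open>p\<close>. For a regular graph this makes the valency of the complement positive, so for
  negative \<open>\<theta>\<close> the denominator in the bound exceeds 1.\<close>

lemma degree_less:
  assumes "p \<in> pverts G" "q \<in> pverts G" "p \<noteq> q" "(p, q) \<notin> parcs G"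
  shows "card (neighbours G p) + 2 \<le> card (pverts G)"
proof -
  have "card (insert p (insert q (neighbours G p))) \<le> card (pverts G)"
    using assms neighbours_subset pair_finite_verts by (intro card_mono) auto
  thus ?thesis using assms adj_irrefl by (simp add: neighbours_def finite_neighbours[unfolded neighbours_def])
qed

lemma sum_adj_clique:
  assumes "clique G C" "u \<in> C"
  shows "(\<Sum>w\<in>pverts G. adj G u w * of_bool (w \<in> C)) = real (card C) - 1"
proof -
  have "neighbours G u \<inter> C = C - {u}"
    using assms adj_irrefl by (auto simp: clique_def neighbours_def)
  moreover have "finite C"
    using assms pair_finite_verts by (auto simp: clique_def intro: finite_subset)
  moreover from this have "card C > 0" using assms(2) by (auto simp: card_gt_0_iff)
  ultimately show ?thesis
    using assms(2) by (simp add: sum_adj_indicator card_Diff_singleton of_nat_diff)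
qed

lemma clique_indicator_sum:
  assumes "C \<subseteq> pverts G"
  shows "(\<Sum>w\<in>pverts G. of_bool (w \<in> C) :: real) = card C"
proof -
  have "(\<Sum>w\<in>pverts G. of_bool (w \<in> C) :: real) = card (pverts G \<inter> C)"
    using pair_finite_verts by (simp add: of_bool_def sum.If_cases)
  thus ?thesis using assms by (simp add: Int_absorb1)
qed

text \<open>On vectors with sum 0 the matrix \<open>J\<close> acts as zero, so the complement acts
  as \<open>- I - A\<close> and a lower bound for it becomes an upper bound for
  \<open>A\<close>.\<close>

lemma form_le_if_complement_form_ge:
  assumes bound: "\<And>y. \<theta> * (\<Sum>u\<in>pverts G. (y u)\<^sup>2)
      \<le> (\<Sum>u\<in>pverts G. \<Sum>w\<in>pverts G. adj (graph_complement G) u w * y u * y w)"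
    and y: "(\<Sum>u\<in>pverts G. y u) = 0"
  shows "(\<Sum>u\<in>pverts G. \<Sum>w\<in>pverts G. adj G u w * y u * y w)
    \<le> (-1 - \<theta>) * (\<Sum>u\<in>pverts G. (y u)\<^sup>2)"
proof -
  have "(\<Sum>u\<in>pverts G. \<Sum>w\<in>pverts G. adj (graph_complement G) u w * y u * y w)
      = (\<Sum>u\<in>pverts G. y u * (\<Sum>w\<in>pverts G. adj (graph_complement G) u w * y w))"
    by (simp add: sum_distrib_left mult_ac)
  also have "\<dots> = (\<Sum>u\<in>pverts G. - (y u)\<^sup>2 - (\<Sum>w\<in>pverts G. adj G u w * y u * y w))"
    by (intro sum.cong refl)
      (simp only: sum_adj_complement y, simp add: algebra_simps power2_eq_square sum_distrib_left)
  finally show ?thesis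
    using bound[of y] by (simp add: sum_subtractf sum_negf algebra_simps)
qed

section \<open>From an attained bound to strong regularity\<close>

lemma strongly_regular_if_bound_attained:
  assumes conn: "Digraph_Component.connected (with_proj G)"
    and nc: "\<not> complete_graph G"
    and er: "edge_regular G" and reg: "regular_graph G k"
    and "\<theta> < 0"
    and bound: "\<And>y. \<theta> * (\<Sum>u\<in>pverts G. (y u)\<^sup>2)
      \<le> (\<Sum>u\<in>pverts G. \<Sum>w\<in>pverts G. adj (graph_complement G) u w * y u * y w)"
    and C: "clique G C"
    and att: "real (card C) = real (card (pverts G)) / (1 - (real (card (pverts G)) - real k - 1) / \<theta>)"
  shows "strongly_regular G \<and> regular_clique G C"
proof -
  let ?V = "pverts G"
  define v where "v = real (card ?V)"
  define s where "s = real (card C)"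
  define \<tau> where "\<tau> = -1 - \<theta>"
  define ind where "ind = (\<lambda>u. of_bool (u \<in> C) :: real)"
  obtain p q where pq: "p \<in> ?V" "q \<in> ?V" "p \<noteq> q" "(p, q) \<notin> parcs G"
    using nonadjacent_pair[OF nc] .
  have V: "finite ?V" "?V \<noteq> {}" using pq pair_finite_verts by auto
  have kv: "real k + 2 \<le> v"
    using degree_less[OF pq] reg pq(1) by (simp add: regular_graph_def v_def)
  have "C \<subseteq> ?V" using C by (simp add: clique_def)
  have "1 - (v - real k - 1) / \<theta> > 0"
    using \<open>\<theta> < 0\<close> kv by (simp add: field_simps)
  hence s: "s * (1 - (v - real k - 1) / \<theta>) = v"
    using att unfolding s_def v_def by (metis less_irrefl nonzero_eq_divide_eq)
  \<comment> \<open>The attained bound with denominators cleared and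
    \<open>\<theta> = -1 - \<tau>\<close> inserted; the common value will be the nexus of
    \<open>C\<close>.\<close>
  hence ratio: "s * (real k - \<tau>) / v = s - 1 - \<tau>"
    using \<open>\<theta> < 0\<close> kv by (simp add: \<tau>_def field_simps)
  have "s > 0" using s kv by (cases "s = 0") (auto simp: s_def)
  have tight: "(\<Sum>w\<in>?V. adj G i w * y w) = \<tau> * y i + (k - \<tau>) / v * (\<Sum>u\<in>?V. y u)"
    if "(\<Sum>u\<in>?V. \<Sum>w\<in>?V. adj G u w * y u * y w)
        = \<tau> * (\<Sum>u\<in>?V. (y u)\<^sup>2) + (k - \<tau>) / v * (\<Sum>u\<in>?V. y u)\<^sup>2" "i \<in> ?V" for y i
    unfolding v_def \<tau>_def
    by (rule second_eigenvalue_equality[OF V adj_sym sum_adj_regular[OF reg]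
          form_le_if_complement_form_ge[OF bound] that[unfolded v_def \<tau>_def]])
  have form: "(\<Sum>u\<in>?V. \<Sum>w\<in>?V. adj G u w * y u * y w) = (\<Sum>u\<in>?V. y u * (\<Sum>w\<in>?V. adj G u w * y w))"
    for y by (simp add: sum_distrib_left mult_ac)
  have "(ind u)\<^sup>2 = ind u" for u by (simp add: ind_def)
  hence ind_sum: "(\<Sum>u\<in>?V. ind u) = s" "(\<Sum>u\<in>?V. (ind u)\<^sup>2) = s"
    using clique_indicator_sum[OF \<open>C \<subseteq> ?V\<close>] by (simp_all only: ind_def s_def)
  have ind_C: "(\<Sum>w\<in>?V. adj G u w * ind w) = s - 1" if "u \<in> C" for u
    using sum_adj_clique[OF C that] by (simp add: ind_def s_def)
  \<comment> \<open>The factor \<open>ind u\<close> discards the rows outside \<open>C\<close>,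
    whose sums are still unknown.\<close>
  have "(\<Sum>u\<in>?V. \<Sum>w\<in>?V. adj G u w * ind u * ind w) = (\<Sum>u\<in>?V. (s - 1) * ind u)"
    unfolding form
  proof (intro sum.cong refl)
    fix u
    have "u \<notin> C \<Longrightarrow> ind u = 0" by (simp add: ind_def)
    thus "ind u * (\<Sum>w\<in>?V. adj G u w * ind w) = (s - 1) * ind u"
      by (cases "u \<in> C") (simp_all add: ind_C)
  qed
  also have "\<dots> = (s - 1) * s" by (simp only: sum_distrib_left[symmetric] ind_sum)
  also have "\<dots> = \<tau> * s + (k - \<tau>) / v * s\<^sup>2"
  proof -
    have "(k - \<tau>) / v * s\<^sup>2 = s * (s * (k - \<tau>) / v)" by (simp add: power2_eq_square)
    thus ?thesis unfolding ratio by (simp add: algebra_simps)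
  qed
  finally have A_ind: "(\<Sum>w\<in>?V. adj G u w * ind w) = \<tau> * ind u + (s - 1 - \<tau>)" if "u \<in> ?V" for u
    using tight[of ind u] that ratio by (simp add: ind_sum mult_ac)
  \<comment> \<open>Tightness makes the number of neighbours in \<open>C\<close> constant off
    \<open>C\<close>, possibly 0; an edge leaving \<open>C\<close> excludes 0.\<close>
  have "C \<noteq> {}" using \<open>s > 0\<close> by (auto simp: s_def)
  moreover have "C \<noteq> ?V" using pq C by (auto simp: clique_def)
  ultimately obtain u0 w0 where u0: "u0 \<in> ?V - C" "w0 \<in> C" "(u0, w0) \<in> parcs G"
    using connected_boundary[OF conn \<open>C \<subseteq> ?V\<close>] by blast
  define e where "e = card (neighbours G u0 \<inter> C)"
  have "e > 0" using u0 by (auto simp: e_def card_gt_0_iff neighbours_def finite_neighbours[unfolded neighbours_def])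
  have outside: "real (card (neighbours G u \<inter> C)) = s - 1 - \<tau>" if "u \<in> ?V - C" for u
    using A_ind[of u] that sum_adj_indicator[of u C] by (simp add: ind_def)
  from outside[OF u0(1)] have e: "real e = s - 1 - \<tau>" by (simp add: e_def)
  have "card (neighbours G u \<inter> C) = e" if "u \<in> ?V - C" for u
    using outside[OF that] e by linarith
  hence "regular_clique G C"
    using C \<open>e > 0\<close> by (auto simp: regular_clique_def)
  \<comment> \<open>Here \<open>s = e - \<theta>\<close> with \<open>e \<ge> 1\<close> and
    \<open>\<theta> < 0\<close>. This permits division by \<open>s - 1\<close>.\<close>
  have "s > 1" using e \<open>e > 0\<close> \<open>\<theta> < 0\<close> by (simp add: \<tau>_def)
  obtain l where l: "\<And>u w. (u, w) \<in> parcs G \<Longrightarrow> card (neighbours G u \<inter> neighbours G w) = l"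
    using er by (auto simp: edge_regular_def)
  have deg: "card (neighbours G u) = k" if "u \<in> ?V" for u
    using reg that by (simp add: regular_graph_def)
  txt \<open>Evaluating \<open>A\<^sup>2 1\<^sub>C\<close> at a vertex of \<open>C\<close> in two ways.\<close>
  have lam: "real k + (s - 1) * real l = (s - 1 - real e) * (s - 1) + real e * real k"
  proof -
    obtain x where "x \<in> C" using \<open>C \<noteq> {}\<close> by blast
    hence "x \<in> ?V" using \<open>C \<subseteq> ?V\<close> by blast
    have "(\<Sum>w\<in>?V. adj G x w * (\<Sum>z\<in>?V. adj G w z * ind z))
        = (\<Sum>z\<in>?V. (\<Sum>w\<in>?V. adj G x w * adj G w z) * ind z)"
      unfolding sum_distrib_left sum_distrib_right by (subst sum.swap) (simp add: mult_ac)
    \<comment> \<open>Only entries of \<open>A\<^sup>2\<close> at \<open>z \<in> C\<close> count: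
      the diagonal one is \<open>k\<close>, and the others are \<open>l\<close> because
      \<open>z\<close> is adjacent to \<open>x\<close> in the clique.\<close>
    also have "\<dots> = (\<Sum>z\<in>?V. l * (adj G x z * ind z) + (if z = x then real k else 0))"
    proof (intro sum.cong refl)
      fix z assume "z \<in> ?V"
      consider "z = x" | "z \<noteq> x" "z \<in> C" | "z \<notin> C" by blast
      thus "(\<Sum>w\<in>?V. adj G x w * adj G w z) * ind z = l * (adj G x z * ind z) + (if z = x then real k else 0)"
      proof cases
        case 1
        thus ?thesis using \<open>x \<in> C\<close> \<open>x \<in> ?V\<close> adj_irrefl
          by (simp add: sum_adj_adj deg ind_def) (simp add: adj_def)
      next
        case 2
        hence "(x, z) \<in> parcs G" using C \<open>x \<in> C\<close> by (auto simp: clique_def)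
        moreover from this have "adj G x z = 1" by (simp add: adj_def)
        ultimately show ?thesis using 2 by (simp add: sum_adj_adj l ind_def)
      next
        case 3
        thus ?thesis using \<open>x \<in> C\<close> by (auto simp: ind_def)
      qed
    qed
    also have "\<dots> = l * (\<Sum>z\<in>?V. adj G x z * ind z) + k"
      using V \<open>x \<in> ?V\<close> by (simp add: sum.distrib sum_distrib_left)
    also have "(\<Sum>w\<in>?V. adj G x w * (\<Sum>z\<in>?V. adj G w z * ind z))
        = (\<Sum>w\<in>?V. \<tau> * (adj G x w * ind w) + e * adj G x w)"
      by (intro sum.cong refl) (simp only: A_ind, simp add: e algebra_simps)
    also have "\<dots> = \<tau> * (s - 1) + e * k"
      using ind_C[OF \<open>x \<in> C\<close>] sum_adj_regular[OF reg \<open>x \<in> ?V\<close>]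
      by (simp add: sum.distrib sum_distrib_left[symmetric])
    finally have "\<tau> * (s - 1) + e * k = l * (s - 1) + k" unfolding ind_C[OF \<open>x \<in> C\<close>] .
    moreover have "\<tau> = s - 1 - e" using e by simp
    ultimately show ?thesis by (simp add: mult.commute)
  qed
  txt \<open>
    If \<open>G\<close> is strongly regular with a regular clique of size \<open>s\<close>, its smallest eigenvalue is
    \<open>- k / (s - 1)\<close>, and the columns of \<open>A + m I\<close> lie in the sum of the other two eigenspaces.
  \<close>
  define m where "m = k / (s - 1)"
  have k: "real k = m * (s - 1)" using \<open>s > 1\<close> by (simp add: m_def)
  define z where "z = (\<lambda>i u. adj G u i + m * of_bool (u = i))"
  have z_sum: "(\<Sum>u\<in>?V. z i u) = k + m" if "i \<in> ?V" for i
    using sum_adj_regular[OF reg that] that V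
    by (simp add: z_def sum.distrib sum_distrib_left[symmetric] adj_sym[of _ i])
  have z_sq: "(\<Sum>u\<in>?V. (z i u)\<^sup>2) = k + m\<^sup>2" if "i \<in> ?V" for i
  proof -
    \<comment> \<open>There are no loops, so the two summands of \<open>z i u\<close> are never both
      nonzero and the cross term vanishes.\<close>
    have "(\<Sum>u\<in>?V. (z i u)\<^sup>2) = (\<Sum>u\<in>?V. adj G u i + m\<^sup>2 * of_bool (u = i))"
      using adj_irrefl by (intro sum.cong refl) (auto simp: z_def adj_def)
    thus ?thesis using sum_adj_regular[OF reg that] that V
      by (simp add: sum.distrib sum_distrib_left[symmetric] adj_sym[of _ i])
  qed
  have A_z: "(\<Sum>w\<in>?V. adj G u w * z i w) = card (neighbours G u \<inter> neighbours G i) + m * adj G u i"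
    if "i \<in> ?V" for u i
  proof -
    have "(\<Sum>w\<in>?V. adj G u w * z i w)
        = (\<Sum>w\<in>?V. adj G u w * adj G w i + (if w = i then m * adj G u w else 0))"
      by (intro sum.cong refl) (auto simp: z_def algebra_simps)
    thus ?thesis using that V by (simp add: sum.distrib sum_adj_adj)
  qed
  \<comment> \<open>The factor \<open>z i u\<close> vanishes when \<open>u\<close> is neither
    \<open>i\<close> nor adjacent to \<open>i\<close>, so the unknown counts of common neighbours do
    not enter; valency and edge-regularity give the rest.\<close>
  have form_z: "(\<Sum>u\<in>?V. \<Sum>w\<in>?V. adj G u w * z i u * z i w) = real k * real l + 2 * m * real k" if "i \<in> ?V" for i
  proof -
    have "(\<Sum>u\<in>?V. \<Sum>w\<in>?V. adj G u w * z i u * z i w)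
        = (\<Sum>u\<in>?V. (l + m) * adj G u i + (if u = i then m * k else 0))"
      unfolding form
    proof (intro sum.cong refl, unfold A_z[OF that])
      fix u assume "u \<in> ?V"
      show "z i u * (card (neighbours G u \<inter> neighbours G i) + m * adj G u i)
          = (l + m) * adj G u i + (if u = i then m * k else 0)"
        using l[of u i] that adj_irrefl
        by (auto simp: z_def adj_def deg)
    qed
    also have "\<dots> = (l + m) * k + m * k"
      using that V sum_adj_regular[OF reg that]
      by (simp add: sum.distrib sum_distrib_left[symmetric] adj_sym[of _ i])
    finally show ?thesis by (simp add: algebra_simps)
  qed
  \<comment> \<open>This says that the semidefinite form vanishes at each \<open>z i\<close>. It is
    checked by expressing \<open>k\<close>, \<open>l\<close>, \<open>\<tau>\<close> and
    \<open>(k - \<tau>) / v\<close> through \<open>s\<close>, \<open>e\<close> and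
    \<open>m\<close>.\<close>
  have "real k * real l + 2 * m * real k = \<tau> * (k + m\<^sup>2) + (k - \<tau>) / v * (k + m)\<^sup>2"
  proof -
    have \<tau>: "\<tau> = s - 1 - e" using e by simp
    have "l * (s - 1) = (s - 1) * (s - 2 + (m - 1) * (real e - 1))"
      using lam unfolding k by (simp add: algebra_simps)
    hence l_eq: "l = s - 2 + (m - 1) * (real e - 1)" using \<open>s > 1\<close> by simp
    have "s * (k - \<tau>) = e * v" using ratio kv unfolding e by (simp add: divide_eq_eq)
    hence "(k - \<tau>) / v = e / s" using kv \<open>s > 0\<close> by (simp add: field_simps)
    moreover have "real k + m = m * s" using k by (simp add: algebra_simps)
    ultimately have "(k - \<tau>) / v * (k + m)\<^sup>2 = e * m\<^sup>2 * s"
      using \<open>s > 0\<close> by (simp add: power2_eq_square)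
    thus ?thesis unfolding l_eq \<tau> k by (simp add: algebra_simps power2_eq_square)
  qed
  \<comment> \<open>For nonadjacent distinct vertices \<open>z i u = 0\<close>, so the kernel
    equation leaves a value independent of the pair. The floor and \<open>nat\<close> merely render
    this real constant as a natural number.\<close>
  hence common: "card (neighbours G u \<inter> neighbours G i) = nat \<lfloor>(k - \<tau>) / v * (k + m)\<rfloor>"
    if "u \<in> ?V" "i \<in> ?V" "u \<noteq> i" "(u, i) \<notin> parcs G" for u i
  proof -
    have "(\<Sum>w\<in>?V. adj G u w * z i w) = \<tau> * z i u + (k - \<tau>) / v * (\<Sum>w\<in>?V. z i w)"
      using \<open>real k * real l + _ = _\<close> that by (intro tight) (simp_all add: form_z z_sq z_sum)
    hence "real (card (neighbours G u \<inter> neighbours G i)) = (k - \<tau>) / v * (k + m)"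
      using that by (simp add: A_z z_sum) (simp add: z_def adj_def)
    thus ?thesis by (metis floor_of_nat nat_int)
  qed
  hence "strongly_regular G"
    using er unfolding strongly_regular_def by blast
  with \<open>regular_clique G C\<close> show ?thesis by blast
qed

section \<open>From strong regularity to an attained bound\<close>

text \<open>Strong regularity means \<open>A\<^sup>2 = k I + l A + m (J - I - A)\<close>. Applied to
  an eigenvector with sum 0, the \<open>J\<close> term drops out, and a nonzero coordinate can be
  cancelled.\<close>

lemma strongly_regular_eigenvalue:
  assumes reg: "regular_graph G k"
    and l: "\<And>u w. (u, w) \<in> parcs G \<Longrightarrow> card (neighbours G u \<inter> neighbours G w) = l"
    and m: "\<And>u w. u \<in> pverts G \<Longrightarrow> w \<in> pverts G \<Longrightarrow> u \<noteq> w \<Longrightarrow> (u, w) \<notin> parcs G \<Longrightarrow>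
      card (neighbours G u \<inter> neighbours G w) = m"
    and x: "(\<Sum>u\<in>pverts G. x u) = 0" "i \<in> pverts G" "x i \<noteq> 0"
    and ev: "\<And>u. u \<in> pverts G \<Longrightarrow> (\<Sum>w\<in>pverts G. adj G u w * x w) = \<tau> * x u"
  shows "\<tau>\<^sup>2 = (real k - real m) + (real l - real m) * \<tau>"
proof -
  let ?V = "pverts G"
  have "\<tau>\<^sup>2 * x i = (\<Sum>w\<in>?V. adj G i w * (\<tau> * x w))"
    using ev[OF x(2)] by (simp add: power2_eq_square mult.left_commute sum_distrib_left[symmetric])
  also have "\<dots> = (\<Sum>w\<in>?V. adj G i w * (\<Sum>z\<in>?V. adj G w z * x z))"
    by (intro sum.cong refl) (simp add: ev)
  also have "\<dots> = (\<Sum>z\<in>?V. (\<Sum>w\<in>?V. adj G i w * adj G w z) * x z)"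
    unfolding sum_distrib_left sum_distrib_right by (subst sum.swap) (simp add: mult_ac)
  also have "\<dots> = (\<Sum>z\<in>?V. (if z = i then (real k - real m) * x z else 0)
      + (real l - real m) * (adj G i z * x z) + real m * x z)"
  proof (intro sum.cong refl)
    fix z assume "z \<in> ?V"
    have eq: "real (card (neighbours G i \<inter> neighbours G z))
        = (if z = i then real k - real m else 0) + (real l - real m) * adj G i z + real m"
    proof -
      consider "z = i" | "(i, z) \<in> parcs G" "z \<noteq> i" | "(i, z) \<notin> parcs G" "z \<noteq> i" by blast
      thus ?thesis
        using reg m[of i z] l[of i z] x(2) \<open>z \<in> ?V\<close> adj_irrefl
        by cases (auto simp: regular_graph_def adj_def)
    qed
    show "(\<Sum>w\<in>?V. adj G i w * adj G w z) * x z
        = (if z = i then (real k - real m) * x z else 0)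
          + (real l - real m) * (adj G i z * x z) + real m * x z"
      unfolding sum_adj_adj eq by (simp add: algebra_simps)
  qed
  also have "\<dots> = (real k - real m) * x i + (real l - real m) * (\<tau> * x i) + real m * 0"
    using pair_finite_verts x(2)
    by (simp add: sum.distrib sum_distrib_left[symmetric] ev[OF x(2)] x(1))
  finally have "\<tau>\<^sup>2 * x i = ((real k - real m) + (real l - real m) * \<tau>) * x i"
    by (simp add: algebra_simps)
  with x(3) show ?thesis by simp
qed

text \<open>The Rayleigh bound yields \<open>\<theta> \<le> -1 - \<tau>\<close>. The eigenvector
  \<open>x\<close> serves for equality: it makes \<open>-1 - \<theta>\<close> a root of the same
  quadratic as \<open>\<tau>\<close>.\<close>

lemma bound_attained_if_strongly_regular:
  assumes nc: "\<not> complete_graph G"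
    and srg: "strongly_regular G" and reg: "regular_graph G k"
    and "\<theta> < 0"
    and bound: "\<And>y. \<theta> * (\<Sum>u\<in>pverts G. (y u)\<^sup>2)
      \<le> (\<Sum>u\<in>pverts G. \<Sum>w\<in>pverts G. adj (graph_complement G) u w * y u * y w)"
    and x: "i \<in> pverts G" "x i \<noteq> 0"
      "\<And>u. u \<in> pverts G \<Longrightarrow> (\<Sum>w\<in>pverts G. adj (graph_complement G) u w * x w) = \<theta> * x u"
    and rc: "regular_clique G C"
  shows "real (card C) = real (card (pverts G)) / (1 - (real (card (pverts G)) - real k - 1) / \<theta>)"
proof -
  let ?V = "pverts G"
  define v where "v = real (card ?V)"
  define s where "s = real (card C)"
  define ind where "ind = (\<lambda>u. of_bool (u \<in> C) :: real)"
  obtain p q where pq: "p \<in> ?V" "q \<in> ?V" "p \<noteq> q" "(p, q) \<notin> parcs G"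
    using nonadjacent_pair[OF nc] .
  have V: "finite ?V" "?V \<noteq> {}" using pq pair_finite_verts by auto
  have deg: "card (neighbours G u) = k" if "u \<in> ?V" for u
    using reg that by (simp add: regular_graph_def)
  have kv: "real k + 2 \<le> v"
    using degree_less[OF pq] deg[OF pq(1)] by (simp add: v_def)
  obtain e where C: "clique G C" and "e > 0"
    and nexus: "\<And>u. u \<in> ?V - C \<Longrightarrow> card (neighbours G u \<inter> C) = e"
    using rc by (auto simp: regular_clique_def)
  have "C \<subseteq> ?V" using C by (simp add: clique_def)
  have "finite C" using \<open>C \<subseteq> ?V\<close> V(1) by (rule finite_subset)
  obtain u0 where u0: "u0 \<in> ?V - C"
    using pq C by (auto simp: clique_def)
  then obtain w0 where w0: "w0 \<in> C" "(u0, w0) \<in> parcs G"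
    using nexus[OF u0] \<open>e > 0\<close> by (fastforce simp: card_gt_0_iff neighbours_def)
  have "e \<le> card C"
    using nexus[OF u0] card_mono[OF \<open>finite C\<close>, of "neighbours G u0 \<inter> C"] by simp
  define \<tau> where "\<tau> = s - 1 - real e"
  have A_ind: "(\<Sum>w\<in>?V. adj G u w * ind w) = \<tau> * ind u + e" if "u \<in> ?V" for u
    using sum_adj_clique[OF C, of u] nexus[of u] that sum_adj_indicator[of u C]
    by (cases "u \<in> C") (simp_all add: ind_def s_def \<tau>_def)
  have ind_sum: "(\<Sum>u\<in>?V. ind u) = s"
    using clique_indicator_sum[OF \<open>C \<subseteq> ?V\<close>] by (simp add: ind_def s_def)
  have col_sum: "(\<Sum>u\<in>?V. \<Sum>w\<in>?V. adj G u w * f w) = real k * (\<Sum>w\<in>?V. f w)"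
    for f :: "'a \<Rightarrow> real"
  proof -
    have "(\<Sum>u\<in>?V. adj G u w * f w) = k * f w" if "w \<in> ?V" for w
      using sum_adj_regular[OF reg that] by (simp add: sum_distrib_right[symmetric] adj_sym[of _ w])
    thus ?thesis by (subst sum.swap) (simp add: sum_distrib_left)
  qed
  \<comment> \<open>The entries of \<open>A 1\<^sub>C\<close> are added up in two ways: by column
    sums, and by the values in \<open>A_ind\<close>.\<close>
  have ve: "k * s = \<tau> * s + e * v"
  proof -
    have "(\<Sum>u\<in>?V. \<Sum>w\<in>?V. adj G u w * ind w) = \<tau> * s + e * v"
      by (simp add: A_ind sum.distrib sum_distrib_left[symmetric] ind_sum v_def)
    thus ?thesis by (simp only: col_sum ind_sum)
  qed
  \<comment> \<open>As \<open>e \<le> card C\<close>, only \<open>e = card C\<close> could make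
    \<open>\<tau>\<close> negative; then \<open>\<tau> = -1\<close>, and \<open>ve\<close> forces
    \<open>v = k + 1\<close>, against \<open>kv\<close>.\<close>
  have "\<tau> \<ge> 0"
  proof -
    have "e \<noteq> card C"
    proof
      assume "e = card C"
      hence "real e = s" by (simp add: s_def)
      hence "s * (real k + 1 - v) = 0" using ve by (simp add: \<tau>_def algebra_simps)
      moreover have "s > 0" using \<open>real e = s\<close> \<open>e > 0\<close> by simp
      ultimately show False using kv by simp
    qed
    with \<open>e \<le> card C\<close> show ?thesis by (simp add: \<tau>_def s_def)
  qed
  have "s > 0" using w0 \<open>finite C\<close> by (auto simp: s_def card_gt_0_iff)
  define y where "y = (\<lambda>u. ind u - s / v)"
  have y_sum: "(\<Sum>u\<in>?V. y u) = 0"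
    using V by (simp add: y_def sum_subtractf ind_sum v_def)
  have A_y: "(\<Sum>w\<in>?V. adj G u w * y w) = \<tau> * y u" if "u \<in> ?V" for u
  proof -
    have "(\<Sum>w\<in>?V. adj G u w * y w) = \<tau> * ind u + e - k * (s / v)"
      using A_ind[OF that] sum_adj_regular[OF reg that]
      by (simp add: y_def right_diff_distrib sum_subtractf
          sum_distrib_right[symmetric] sum_divide_distrib[symmetric])
    moreover have "k * (s / v) = \<tau> * (s / v) + e"
      using ve kv by (simp add: field_simps)
    ultimately show ?thesis by (simp add: y_def algebra_simps)
  qed
  have "y u0 \<noteq> 0" using u0 \<open>s > 0\<close> kv by (simp add: y_def ind_def)
  have "\<theta> \<le> -1 - \<tau>"
  proof -
    have "(\<Sum>u\<in>?V. \<Sum>w\<in>?V. adj G u w * y u * y w) = (\<Sum>u\<in>?V. y u * (\<Sum>w\<in>?V. adj G u w * y w))"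
      by (simp add: sum_distrib_left mult_ac)
    also have "\<dots> = (\<Sum>u\<in>?V. \<tau> * (y u)\<^sup>2)"
      by (intro sum.cong refl) (simp add: A_y power2_eq_square)
    also have "\<dots> = \<tau> * (\<Sum>u\<in>?V. (y u)\<^sup>2)" by (simp add: sum_distrib_left)
    finally have "\<tau> * (\<Sum>u\<in>?V. (y u)\<^sup>2) \<le> (-1 - \<theta>) * (\<Sum>u\<in>?V. (y u)\<^sup>2)"
      using form_le_if_complement_form_ge[OF bound y_sum] by simp
    moreover have "(\<Sum>u\<in>?V. (y u)\<^sup>2) > 0"
      using V(1) u0 \<open>y u0 \<noteq> 0\<close> by (intro sum_pos2[of _ u0]) auto
    ultimately show ?thesis by simp
  qed
  obtain l m where l: "\<And>u w. (u, w) \<in> parcs G \<Longrightarrow> card (neighbours G u \<inter> neighbours G w) = l"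
    and m: "\<And>u w. u \<in> ?V \<Longrightarrow> w \<in> ?V \<Longrightarrow> u \<noteq> w \<Longrightarrow> (u, w) \<notin> parcs G \<Longrightarrow>
      card (neighbours G u \<inter> neighbours G w) = m"
    using srg unfolding strongly_regular_def edge_regular_def by fast
  have "l \<le> k" "m \<le> k"
    using card_common_neighbours_le[of u0 w0] card_common_neighbours_le[of p q]
      l[OF w0(2)] m[OF pq] deg u0 pq(1) by auto
  \<comment> \<open>The complement has constant row sum \<open>v - 1 - k\<close>, which is positive
    and so differs from \<open>\<theta>\<close>; by symmetry \<open>x\<close> is orthogonal to the
    all-one vector.\<close>
  have x_sum: "(\<Sum>u\<in>?V. x u) = 0"
  proof -
    have "(\<Sum>u\<in>?V. \<Sum>w\<in>?V. adj (graph_complement G) u w * x w)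
        = (\<Sum>u\<in>?V. (\<Sum>w\<in>?V. x w) - x u - (\<Sum>w\<in>?V. adj G u w * x w))"
      by (intro sum.cong refl sum_adj_complement)
    also have "\<dots> = v * (\<Sum>w\<in>?V. x w) - (\<Sum>u\<in>?V. x u) - (\<Sum>u\<in>?V. \<Sum>w\<in>?V. adj G u w * x w)"
      by (simp add: sum_subtractf v_def)
    also have "(\<Sum>u\<in>?V. \<Sum>w\<in>?V. adj G u w * x w) = k * (\<Sum>w\<in>?V. x w)"
      by (simp only: col_sum sum_distrib_left)
    also have "(\<Sum>u\<in>?V. \<Sum>w\<in>?V. adj (graph_complement G) u w * x w) = \<theta> * (\<Sum>w\<in>?V. x w)"
      by (simp add: x(3) sum_distrib_left)
    finally have "(v - 1 - k - \<theta>) * (\<Sum>w\<in>?V. x w) = 0" by (simp add: algebra_simps)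
    thus ?thesis using kv \<open>\<theta> < 0\<close> by simp
  qed
  have A_x: "(\<Sum>w\<in>?V. adj G u w * x w) = (-1 - \<theta>) * x u" if "u \<in> ?V" for u
    using x(3)[OF that] sum_adj_complement[OF that, of x] x_sum by (simp add: algebra_simps)
  have q\<theta>: "(-1 - \<theta>)\<^sup>2 = (real k - real m) + (real l - real m) * (-1 - \<theta>)"
    by (rule strongly_regular_eigenvalue[OF reg l m x_sum x(1,2) A_x])
  have q\<tau>: "\<tau>\<^sup>2 = (real k - real m) + (real l - real m) * \<tau>"
    using u0 by (intro strongly_regular_eigenvalue[OF reg l m y_sum _ \<open>y u0 \<noteq> 0\<close> A_y]) auto
  txt \<open>The two roots of the quadratic have product \<open>m - k \<le> 0\<close>, so \<open>\<tau> \<ge> 0\<close> is the larger one.\<close>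
  have "\<theta> = -1 - \<tau>"
  proof (rule ccontr)
    define \<sigma> where "\<sigma> = -1 - \<theta>"
    assume "\<theta> \<noteq> -1 - \<tau>"
    hence "\<sigma> > \<tau>" using \<open>\<theta> \<le> -1 - \<tau>\<close> by (simp add: \<sigma>_def)
    have "(\<sigma> - \<tau>) * (\<sigma> + \<tau> - (real l - real m)) = 0"
      using q\<theta> q\<tau> unfolding \<sigma>_def[symmetric] by (simp add: algebra_simps power2_eq_square)
    hence sum: "\<sigma> = real l - real m - \<tau>" using \<open>\<sigma> > \<tau>\<close> by simp
    have prod: "\<sigma> * \<tau> = real m - real k"
      using q\<tau> unfolding sum by (simp add: algebra_simps power2_eq_square)
    \<comment> \<open>With \<open>m \<le> k\<close> this leaves only \<open>m = k\<close> and
      \<open>\<tau> = 0\<close>; then \<open>\<sigma> = l - k\<close> cannot be positive.\<close>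
    have "\<sigma> * \<tau> \<ge> 0" using \<open>\<sigma> > \<tau>\<close> \<open>\<tau> \<ge> 0\<close> by simp
    with prod \<open>m \<le> k\<close> have "m = k" by simp
    with prod \<open>\<sigma> > \<tau>\<close> \<open>\<tau> \<ge> 0\<close> have "\<tau> = 0" by simp
    with sum \<open>m = k\<close> \<open>l \<le> k\<close> \<open>\<sigma> > \<tau>\<close> show False by simp
  qed
  hence \<theta>: "\<theta> = e - s" by (simp add: \<tau>_def)
  have "s * (1 - (v - k - 1) / \<theta>) = v"
  proof -
    \<comment> \<open>A rearrangement of \<open>ve\<close>, since
      \<open>e - s + 1 = - \<tau>\<close>.\<close>
    have "s * (\<theta> - (v - k - 1)) = v * \<theta>"
      using ve unfolding \<theta> \<tau>_def by (simp add: algebra_simps)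
    thus ?thesis using \<open>\<theta> < 0\<close> by (simp add: field_simps)
  qed
  moreover have "1 - (v - k - 1) / \<theta> > 0"
    using \<open>\<theta> < 0\<close> kv by (simp add: field_simps)
  ultimately have "s = v / (1 - (v - k - 1) / \<theta>)"
    by (metis less_irrefl nonzero_eq_divide_eq)
  thus ?thesis by (simp add: s_def v_def)
qed

section \<open>Sign of the complement's smallest eigenvalue, and the equivalence\<close>

text \<open>Two vertices nonadjacent in \<open>G\<close> are adjacent in the complement. The
  difference of their unit vectors has form value -2 and squared norm 2, so even
  \<open>\<theta> \<le> -1\<close>.\<close>

lemma complement_eigenvalue_negative:
  assumes nc: "\<not> complete_graph G"
    and bound: "\<And>y. \<theta> * (\<Sum>u\<in>pverts G. (y u)\<^sup>2)
      \<le> (\<Sum>u\<in>pverts G. \<Sum>w\<in>pverts G. adj (graph_complement G) u w * y u * y w)"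
  shows "\<theta> < 0"
proof -
  let ?V = "pverts G"
  obtain p q where pq: "p \<in> ?V" "q \<in> ?V" "p \<noteq> q" "(p, q) \<notin> parcs G"
    using nonadjacent_pair[OF nc] .
  define a where "a = adj (graph_complement G)"
  have a: "a p p = 0" "a q q = 0" "a p q = 1" "a q p = 1"
    using pq arcs_symmetric[of q p] by (auto simp: a_def adj_def graph_complement_def)
  define y :: "'a \<Rightarrow> real" where "y = (\<lambda>u. of_bool (u = p) - of_bool (u = q))"
  have pick: "(\<Sum>u\<in>?V. f u * y u) = f p - f q" for f
  proof -
    have "(\<Sum>u\<in>?V. f u * y u) = (\<Sum>u\<in>?V. (if u = p then f u else 0) - (if u = q then f u else 0))"
      by (intro sum.cong refl) (auto simp: y_def)
    thus ?thesis using pq pair_finite_verts by (simp add: sum_subtractf)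
  qed
  have "(\<Sum>u\<in>?V. \<Sum>w\<in>?V. a u w * y u * y w) = (\<Sum>u\<in>?V. (a u p - a u q) * y u)"
    by (simp only: pick left_diff_distrib)
  also have "\<dots> = -2" by (simp only: pick) (simp add: a)
  finally have "\<theta> * (\<Sum>u\<in>?V. y u * y u) \<le> -2"
    using bound[of y] by (simp add: a_def power2_eq_square)
  moreover have "(\<Sum>u\<in>?V. y u * y u) = 2"
    using pq by (simp add: pick) (simp add: y_def)
  ultimately show ?thesis by simp
qed

end

theorem theorem2p30:
  fixes G :: "'a pair_pre_digraph" and vs :: "'a list"
    and v k :: nat and \<theta> :: real
  assumes "pair_graph G"
    and "Digraph_Component.connected (with_proj G)"
    and "\<not> complete_graph G"
    and "edge_regular G"
    and "card (pverts G) = v"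
    and "regular_graph G k"
    and "distinct vs" and "set vs = pverts G"
    and "\<theta> = smallest_eigenvalue (adjacency_matrix vs (graph_complement G))"
  shows "(strongly_regular G \<and> neumaier_graph G) \<longleftrightarrow>
    (\<exists>C. clique G C \<and> real (card C) = real v / (1 - (real v - real k - 1) / \<theta>))"
proof -
  interpret pair_graph G by fact
  \<comment> \<open>This gives the matrix positive dimension, so that its spectrum has a
    minimum.\<close>
  have "pverts G \<noteq> {}" using nonadjacent_pair[OF assms(3)] by blast
  hence "vs \<noteq> []" using assms(8) by auto
  have \<theta>: "\<theta> = smallest_eigenvalue (mat (length vs) (length vs)
      (\<lambda>(i, j). adj (graph_complement G) (vs ! i) (vs ! j)))"
    using assms(9) by (simp add: adjacency_matrix_def adj_def of_bool_def)
  note bound = smallest_eigenvalue_Rayleigh[OF assms(7) \<open>vs \<noteq> []\<close> adj_complement_sym \<theta>,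
      unfolded assms(8)]
  obtain x i where x: "i \<in> pverts G" "x i \<noteq> 0"
    "\<And>u. u \<in> pverts G \<Longrightarrow> (\<Sum>w\<in>pverts G. adj (graph_complement G) u w * x w) = \<theta> * x u"
    using smallest_eigenvalue_eigenvector[OF assms(7) \<open>vs \<noteq> []\<close> adj_complement_sym \<theta>]
    unfolding assms(8) by blast
  have "\<theta> < 0" using complement_eigenvalue_negative[OF assms(3) bound] .
  show ?thesis
  proof
    assume "strongly_regular G \<and> neumaier_graph G"
    then obtain C where "strongly_regular G" "regular_clique G C"
      by (auto simp: neumaier_graph_def)
    with bound_attained_if_strongly_regular[OF assms(3) _ assms(6) \<open>\<theta> < 0\<close> bound x]
    show "\<exists>C. clique G C \<and> real (card C) = real v / (1 - (real v - real k - 1) / \<theta>)"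
      using assms(5) by (auto simp: regular_clique_def)
  next
    assume "\<exists>C. clique G C \<and> real (card C) = real v / (1 - (real v - real k - 1) / \<theta>)"
    then obtain C where "clique G C" "real (card C) = real v / (1 - (real v - real k - 1) / \<theta>)"
      by blast
    with strongly_regular_if_bound_attained[OF assms(2,3,4,6) \<open>\<theta> < 0\<close> bound] assms(5)
    have "strongly_regular G \<and> regular_clique G C" by blast
    thus "strongly_regular G \<and> neumaier_graph G"
      using assms(3,4) by (auto simp: neumaier_graph_def)
  qed
qed

end
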